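(* Let $d \ge 1$ and let $\{A_k\}_{k=1}^\infty$ be a sequence of finite subsets of $\mathbb{R}_+^d$ satisfying $\# A_k \ge 2$ for each $k \ge 1$. For each $n \ge 1$ let $\nu_n = \delta_{A_1} * \delta_{A_2} * \cdots * \delta_{A_n}$. Suppose that $\sup\{\# A_k : k \ge 1\} < \infty$. Then the sequence of convolutions $\{\nu_n\}$ converges weakly to a Borel probability measure on $\mathbb{R}^d$ if and only if $$\sum_{k=1}^{\infty} \max\{|a| : a\in A_k\} < \infty.$$
   Context: Notation: $\mathbb{R}_+ = [0,+\infty)$; $\#$ denotes the cardinality of a set; $|a|$ is the Euclidean norm of $a\in\mathbb{R}^d$. For a finite nonempty set $A \subseteq \mathbb{R}^d$, $\delta_A = \frac{1}{\# A} \sum_{a \in A} \delta_a$ is the uniform discrete probability measure on $A$, where $\delta_a$ is the Dirac measure at $a$. The symbol $*$ denotes convolution of measures. A sequence of Borel probability measures $\mu_n$ on $\mathbb{R}^d$ converges weakly to a Borel probability measure $\mu$ if $\int f \, d\mu_n \to \int f \, d\mu$ for every bounded continuous function $f$ on $\mathbb{R}^d$. *)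

theory Defs
  imports "HOL-Probability.Probability"
begin

definition unif_dirac :: "'a::topological_space set \<Rightarrow> 'a measure" where
  "unif_dirac A = measure_of UNIV (sets borel)
     (\<lambda>B. ennreal (1 / real (card A)) * (\<Sum>a\<in>A. emeasure (return borel a) B))"

text \<open>\<^const>\<open>measure_of\<close> silently yields the null measure if its third argument is not a measure;
  \<open>emeasure_unif_dirac\<close> shows that this does not happen here.\<close>

lemma sets_unif_dirac [simp, measurable_cong]: "sets (unif_dirac A) = sets borel"
  unfolding unif_dirac_def using sets.sigma_sets_eq[of borel] by simp

lemma emeasure_unif_dirac:
  assumes "B \<in> sets borel"
  shows "emeasure (unif_dirac A) B =
    ennreal (1 / real (card A)) * (\<Sum>a\<in>A. emeasure (return borel a) B)"
proof (rule emeasure_measure_of[OF unif_dirac_def])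
  show "countably_additive (sets (unif_dirac A))
      (\<lambda>B. ennreal (1 / real (card A)) * (\<Sum>a\<in>A. emeasure (return borel a) B))"
  proof (rule countably_additiveI)
    fix F :: "nat \<Rightarrow> 'a set"
    assume F: "range F \<subseteq> sets (unif_dirac A)" "disjoint_family F"
    then have "(\<Sum>i. emeasure (return borel a) (F i)) = emeasure (return borel a) (\<Union> (range F))" for a
      by (intro suminf_emeasure) auto
    then show "(\<Sum>i. ennreal (1 / real (card A)) * (\<Sum>a\<in>A. emeasure (return borel a) (F i))) =
        ennreal (1 / real (card A)) * (\<Sum>a\<in>A. emeasure (return borel a) (\<Union> (range F)))"
      by (simp add: suminf_sum)
  qed
qed (use assms in \<open>auto simp: positive_def\<close>)

lemma prob_space_unif_dirac:
  assumes "finite A" "A \<noteq> {}"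
  shows "prob_space (unif_dirac A)"
proof
  have "space (unif_dirac A) = UNIV"
    using sets_eq_imp_space_eq[OF sets_unif_dirac[of A]] by simp
  moreover have "emeasure (return borel a) UNIV = 1" for a :: 'a
    by simp
  moreover have "ennreal (1 / real (card A)) * ennreal (real (card A)) = 1"
    using assms by (simp flip: ennreal_mult')
  ultimately show "emeasure (unif_dirac A) (space (unif_dirac A)) = 1"
    by (simp add: emeasure_unif_dirac ennreal_of_nat_eq_real_of_nat)
qed

text \<open>The measures are numbered from 1: \<open>conv_upto M n = M 1 \<star> \<dots> \<star> M n\<close> for \<open>n \<ge> 1\<close>.
  The value at 0 is a convention (the empty convolution); \<open>M 0\<close> is never used.\<close>

fun conv_upto :: "(nat \<Rightarrow> 'a::ordered_euclidean_space measure) \<Rightarrow> nat \<Rightarrow> 'a measure" where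
  "conv_upto M 0 = return borel 0"
| "conv_upto M (Suc 0) = M 1"
| "conv_upto M (Suc (Suc n)) = (conv_upto M (Suc n) \<star> M (Suc (Suc n)))"

definition converges_weakly :: "(nat \<Rightarrow> 'a::topological_space measure) \<Rightarrow> 'a measure \<Rightarrow> bool" where
  "converges_weakly N \<mu> \<longleftrightarrow>
     (\<forall>f :: 'a \<Rightarrow> real. continuous_on UNIV f \<and> bounded (range f) \<longrightarrow>
        (\<lambda>n. integral\<^sup>L (N n) f) \<longlonglongrightarrow> integral\<^sup>L \<mu> f)"

end

theory Submission
  imports Defs
begin

text \<open>Realise the convolutions as the laws of the partial sums \<open>S n\<close> of independent \<open>\<omega> i\<close>, uniform
  on \<open>A (Suc i)\<close>. If the maximal norms are summable, the series converges almost surely, hence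
  in law. Conversely, test against \<open>f x = exp (- \<bar>x\<bar>\<^sub>1)\<close>, which is bounded, continuous and, on the
  nonnegative orthant, multiplicative: the expectations of \<open>f (S n)\<close> are the partial products of
  \<open>p i = E (f (\<omega> i))\<close>, and they tend to the integral of \<open>f\<close> against the limit, which is positive.
  Hence the \<open>1 - p i\<close> are summable. If \<open>K\<close> bounds the cardinalities and \<open>m i\<close> is the maximal norm,
  the atom attaining \<open>m i\<close> gives \<open>1 - p i \<ge> (1 - exp (- m i)) / K\<close>, so the \<open>m i\<close> are summable.\<close>

section \<open>Uniform measures on finite sets\<close>

lemma measurable_uniform_count_measure:
  "f \<in> measurable (uniform_count_measure A) N \<longleftrightarrow> f \<in> A \<rightarrow> space N"
  by (auto simp: measurable_def space_uniform_count_measure sets_uniform_count_measure)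

text \<open>Makes the library facts on \<open>uniform_count_measure\<close> available for integrals
  and null sets. The pushforward along the identity only replaces the power set of \<open>A\<close>
  by the Borel sets of the whole space.\<close>

lemma unif_dirac_eq_distr:
  fixes A :: "'a::t1_space set"
  assumes "finite A" "A \<noteq> {}"
  shows "unif_dirac A = distr (uniform_count_measure A) borel (\<lambda>x. x)"
proof (rule measure_eqI)
  fix B assume "B \<in> sets (unif_dirac A)"
  then have B: "B \<in> sets borel" by simp
  have "(\<Sum>a\<in>A. emeasure (return borel a) B) = of_nat (card (B \<inter> A))"
    using B assms by (simp add: indicator_def sum.If_cases Int_commute Int_def)
  then show "emeasure (unif_dirac A) B = emeasure (distr (uniform_count_measure A) borel (\<lambda>x. x)) B"
    using B assms
    by (simp add: emeasure_unif_dirac emeasure_distr space_uniform_count_measure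
        measurable_uniform_count_measure emeasure_uniform_count_measure
        ennreal_of_nat_eq_real_of_nat flip: ennreal_mult')
qed simp

lemma integral_unif_dirac:
  fixes f :: "'a::t1_space \<Rightarrow> real"
  assumes "finite A" "A \<noteq> {}" and [measurable]: "f \<in> borel_measurable borel"
  shows "integral\<^sup>L (unif_dirac A) f = (\<Sum>a\<in>A. f a) / card A"
  unfolding unif_dirac_eq_distr[OF assms(1,2)]
  by (subst integral_distr)
     (simp_all add: integral_uniform_count_measure assms measurable_uniform_count_measure)

lemma AE_unif_dirac:
  fixes A :: "'a::t1_space set"
  assumes "finite A" "A \<noteq> {}"
  shows "AE x in unif_dirac A. x \<in> A"
  unfolding unif_dirac_eq_distr[OF assms]
proof (subst AE_distr_iff)
  show "(\<lambda>x. x) \<in> borel_measurable (uniform_count_measure A)"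
    by (simp add: measurable_uniform_count_measure)
  show "{x \<in> space borel. x \<in> A} \<in> sets borel"
    using borel_closed[OF finite_imp_closed[OF assms(1)]] by simp
  show "AE x in uniform_count_measure A. x \<in> A"
    by (rule AE_I2) (simp add: space_uniform_count_measure)
qed

section \<open>Partial sums of independent coordinates\<close>

text \<open>Independence means that the joint law is the product of the marginal laws. Here the
  joint law of the coordinates is \<open>PiM UNIV M\<close> itself and the marginals are the
  \<open>M i\<close>; passing to \<open>borel\<close> as target changes neither, since the
  sigma-algebras agree.\<close>

lemma indep_vars_PiM_borel:
  fixes M :: "'i \<Rightarrow> 'a::topological_space measure"
  assumes "\<And>i. prob_space (M i)" "\<And>i. sets (M i) = sets borel"
  shows "prob_space.indep_vars (PiM UNIV M) (\<lambda>_. borel) (\<lambda>i \<omega>. \<omega> i) UNIV"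
proof -
  interpret PP: product_prob_space M UNIV
    by (intro product_prob_spaceI assms)
  have rv: "(\<lambda>\<omega>. \<omega> i) \<in> measurable (PiM UNIV M) borel" for i
    using measurable_component_singleton[of i UNIV M] assms(2)[of i]
    by (simp cong: measurable_cong_sets)
  have "distr (PiM UNIV M) (PiM UNIV (\<lambda>_. borel)) (\<lambda>x. \<lambda>i\<in>UNIV. x i)
      = distr (PiM UNIV M) (PiM UNIV M) (\<lambda>x. x)"
    by (rule distr_cong) (auto intro!: sets_PiM_cong simp: assms)
  also have "\<dots> = PiM UNIV M"
    by (rule distr_id)
  also have "\<dots> = (\<Pi>\<^sub>M i\<in>UNIV. distr (PiM UNIV M) borel (\<lambda>\<omega>. \<omega> i))"
  proof (rule PiM_cong)
    fix i
    have "distr (PiM UNIV M) borel (\<lambda>\<omega>. \<omega> i) = distr (PiM UNIV M) (M i) (\<lambda>\<omega>. \<omega> i)"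
      by (rule distr_cong) (simp_all add: assms)
    then show "M i = distr (PiM UNIV M) borel (\<lambda>\<omega>. \<omega> i)"
      by (simp add: PP.PiM_component)
  qed simp
  finally show ?thesis
    by (subst prob_space.indep_vars_iff_distr_eq_PiM)
      (simp_all add: rv prob_space_PiM assms)
qed

text \<open>Induction on \<open>n\<close>: adding an independent variable convolves the laws.
  Coordinate \<open>i\<close> carries \<open>M (Suc i)\<close>, so the \<open>n + 1\<close>
  coordinates in \<open>{..n}\<close> account for exactly the factors \<open>M 1\<close> to
  \<open>M (Suc n)\<close>.\<close>

lemma distr_sum_eq_conv_upto:
  fixes M :: "nat \<Rightarrow> 'a::ordered_euclidean_space measure"
  assumes prob: "\<And>k. k \<ge> 1 \<Longrightarrow> prob_space (M k)"
    and sets: "\<And>k. k \<ge> 1 \<Longrightarrow> sets (M k) = sets borel"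
  shows "distr (\<Pi>\<^sub>M i\<in>UNIV. M (Suc i)) borel (\<lambda>\<omega>. \<Sum>i\<le>n. \<omega> i) = conv_upto M (Suc n)"
proof -
  define P where "P = (\<Pi>\<^sub>M i\<in>UNIV. M (Suc i))"
  interpret PP: product_prob_space "\<lambda>i. M (Suc i)" UNIV
    by (intro product_prob_spaceI prob) simp
  interpret P: prob_space P
    unfolding P_def by (rule prob_space_PiM) (simp add: prob)
  have ind: "P.indep_vars (\<lambda>_. borel) (\<lambda>i \<omega>. \<omega> i) UNIV"
    unfolding P_def by (rule indep_vars_PiM_borel) (simp_all add: prob sets)
  then have rv [measurable]: "(\<lambda>\<omega>. \<omega> i) \<in> borel_measurable P" for i
    by (simp add: P.indep_vars_def)
  have comp: "distr P borel (\<lambda>\<omega>. \<omega> i) = M (Suc i)" for i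
  proof -
    have "distr P borel (\<lambda>\<omega>. \<omega> i) = distr P (M (Suc i)) (\<lambda>\<omega>. \<omega> i)"
      by (rule distr_cong) (simp_all add: sets)
    then show ?thesis
      by (simp add: PP.PiM_component P_def)
  qed
  have "distr P borel (\<lambda>\<omega>. \<Sum>i\<le>n. \<omega> i) = conv_upto M (Suc n)"
  proof (induction n)
    case (Suc n)
    \<comment> \<open>The old sum and the new term are functions of disjoint blocks of coordinates,
      hence independent.\<close>
    have "P.indep_var borel ((\<lambda>f. \<Sum>i\<le>n. f i) \<circ> (\<lambda>\<omega>. restrict (\<lambda>i. \<omega> i) {..n}))
        borel ((\<lambda>f. f (Suc n)) \<circ> (\<lambda>\<omega>. restrict (\<lambda>i. \<omega> i) {Suc n}))"
      by (intro P.indep_var_compose[OF P.indep_var_restrict[OF ind]]) auto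
    then have "P.indep_var borel (\<lambda>\<omega>. \<Sum>i\<le>n. \<omega> i) borel (\<lambda>\<omega>. \<omega> (Suc n))"
      by (simp add: o_def cong: sum.cong_simp)
    then have "distr P borel (\<lambda>\<omega>. (\<Sum>i\<le>n. \<omega> i) + \<omega> (Suc n))
        = (distr P borel (\<lambda>\<omega>. \<Sum>i\<le>n. \<omega> i) \<star> distr P borel (\<lambda>\<omega>. \<omega> (Suc n)))"
      by (intro P.sum_indep_random_variable) auto
    then show ?case
      by (simp add: comp Suc.IH)
  qed (simp add: comp)
  then show ?thesis
    by (simp add: P_def)
qed

section \<open>Summability criteria for real sequences\<close>

text \<open>The partial products decrease, so each is at least \<open>L\<close>. Since
  \<open>p i \<le> exp (- (1 - p i))\<close>, each is at most the exponential of minus the partial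
  sum, and taking logarithms bounds all partial sums by \<open>- ln L\<close>.\<close>

lemma summable_if_prod_tendsto_pos:
  fixes p :: "nat \<Rightarrow> real"
  assumes p: "\<And>i. 0 \<le> p i" "\<And>i. p i \<le> 1"
    and lim: "(\<lambda>n. \<Prod>i\<le>n. p i) \<longlonglongrightarrow> L" and "0 < L"
  shows "summable (\<lambda>i. 1 - p i)"
proof (rule summableI_nonneg_bounded)
  have "decseq (\<lambda>n. \<Prod>i\<le>n. p i)"
    by (rule decseq_SucI) (simp add: mult_left_le p prod_nonneg)
  then have L: "L \<le> (\<Prod>i\<le>n. p i)" for n
    using lim by (rule decseq_ge)
  fix n
  have "(\<Prod>i\<le>n. p i) \<le> (\<Prod>i\<le>n. exp (- (1 - p i)))"
  proof (rule prod_mono, intro conjI p)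
    show "p i \<le> exp (- (1 - p i))" for i
      using exp_ge_add_one_self[of "- (1 - p i)"] by simp
  qed
  also have "\<dots> = exp (- (\<Sum>i\<le>n. 1 - p i))"
    by (simp only: exp_sum[symmetric] finite_atMost sum_negf)
  finally have "L \<le> exp (- (\<Sum>i\<le>n. 1 - p i))"
    using L[of n] by linarith
  then have "ln L \<le> - (\<Sum>i\<le>n. 1 - p i)"
    using \<open>0 < L\<close> by (metis ln_exp ln_mono)
  moreover have "(\<Sum>i<n. 1 - p i) \<le> (\<Sum>i\<le>n. 1 - p i)"
    by (rule sum_mono2) (auto simp: p)
  ultimately show "(\<Sum>i<n. 1 - p i) \<le> - ln L"
    by linarith
qed (simp add: p)

text \<open>The terms of the given series tend to 0, so eventually \<open>exp (m i) \<le> 2\<close>,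
  and then \<open>m i \<le> exp (m i) - 1 = exp (m i) * (1 - exp (- m i))\<close> is at most twice
  the given term.\<close>

lemma summable_if_summable_one_minus_exp:
  fixes m :: "nat \<Rightarrow> real"
  assumes "\<And>i. 0 \<le> m i" and sm: "summable (\<lambda>i. 1 - exp (- m i))"
  shows "summable m"
proof (rule summable_comparison_test_ev)
  have "eventually (\<lambda>i. 1 - exp (- m i) < 1 / 2) sequentially"
    by (rule order_tendstoD(2)[OF summable_LIMSEQ_zero[OF sm]]) simp
  then show "eventually (\<lambda>i. norm (m i) \<le> 2 * (1 - exp (- m i))) sequentially"
  proof eventually_elim
    case (elim i)
    have "m i \<le> exp (m i) - 1"
      using exp_ge_add_one_self[of "m i"] by linarith
    also have "\<dots> = exp (m i) * (1 - exp (- m i))"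
      by (simp add: algebra_simps flip: exp_add)
    also have "\<dots> \<le> 2 * (1 - exp (- m i))"
    proof (rule mult_right_mono)
      have "exp (m i) * (1 / 2) \<le> exp (m i) * exp (- m i)"
        using elim by (intro mult_left_mono) auto
      then show "exp (m i) \<le> 2"
        by (simp flip: exp_add)
    qed (simp add: assms)
    finally show ?case
      using assms(1)[of i] by simp
  qed
  show "summable (\<lambda>i. 2 * (1 - exp (- m i)))"
    by (rule summable_mult) (rule sm)
qed

section \<open>Weak convergence and the exponential test function\<close>

text \<open>Dominated convergence: a bound of the test function is a constant, which is integrable
  over a probability space.\<close>

lemma converges_weakly_if_AE_tendsto:
  fixes S :: "nat \<Rightarrow> 'b \<Rightarrow> 'a::metric_space"
  assumes "prob_space P"
    and [measurable]: "\<And>n. S n \<in> borel_measurable P" "T \<in> borel_measurable P"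
    and lim: "AE \<omega> in P. (\<lambda>n. S n \<omega>) \<longlonglongrightarrow> T \<omega>"
  shows "converges_weakly (\<lambda>n. distr P borel (S n)) (distr P borel T)"
  unfolding converges_weakly_def
proof (intro allI impI)
  interpret P: prob_space P by fact
  fix f :: "'a \<Rightarrow> real"
  assume f: "continuous_on UNIV f \<and> bounded (range f)"
  then have [measurable]: "f \<in> borel_measurable borel"
    by (intro borel_measurable_continuous_onI) auto
  obtain B where B: "norm (f x) \<le> B" for x
    using f by (auto simp: bounded_iff)
  have "(\<lambda>n. \<integral>\<omega>. f (S n \<omega>) \<partial>P) \<longlonglongrightarrow> (\<integral>\<omega>. f (T \<omega>) \<partial>P)"
  proof (rule integral_dominated_convergence[where w = "\<lambda>_. B"])
    show "AE \<omega> in P. (\<lambda>n. f (S n \<omega>)) \<longlonglongrightarrow> f (T \<omega>)"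
      using lim
    proof eventually_elim
      case (elim \<omega>)
      have "isCont f (T \<omega>)"
        using f by (simp add: continuous_on_eq_continuous_at)
      then show ?case
        using elim by (rule isCont_tendsto_compose)
    qed
  qed (use B in auto)
  then show "(\<lambda>n. integral\<^sup>L (distr P borel (S n)) f) \<longlonglongrightarrow> integral\<^sup>L (distr P borel T) f"
    by (simp add: integral_distr)
qed

text \<open>An atom \<open>b\<close> of maximal norm contributes at most
  \<open>exp (- norm b)\<close>, because the Euclidean norm is at most the l1 norm; every other atom
  contributes at most 1. Replacing \<open>card A\<close> by \<open>K\<close> makes the estimate
  uniform over sets of bounded size.\<close>

lemma integral_exp_l1_unif_dirac_le:
  fixes A :: "(real ^ 'n) set"
  assumes "finite A" "A \<noteq> {}" "card A \<le> K"
  shows "integral\<^sup>L (unif_dirac A) (\<lambda>x. exp (- (\<Sum>j\<in>UNIV. \<bar>x $ j\<bar>)))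
     \<le> 1 - (1 - exp (- Max (norm ` A))) / K"
proof -
  let ?f = "\<lambda>x::real^'n. exp (- (\<Sum>j\<in>UNIV. \<bar>x $ j\<bar>))"
  obtain b where b: "b \<in> A" "Max (norm ` A) = norm b"
    using Max_in[of "norm ` A"] assms by fastforce
  have "?f b \<le> exp (- norm b)"
    by (simp add: norm_le_l1_cart)
  moreover have "sum ?f (A - {b}) \<le> real (card (A - {b})) * 1"
    by (rule sum_bounded_above) (simp add: sum_nonneg)
  moreover have "real (card A) = real (card (A - {b})) + 1"
    using card.remove[OF \<open>finite A\<close> b(1)] by simp
  ultimately have "sum ?f A \<le> real (card A) - (1 - exp (- norm b))"
    using sum.remove[OF \<open>finite A\<close> b(1), of ?f] by linarith
  then have "sum ?f A / card A \<le> (card A - (1 - exp (- norm b))) / card A"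
    by (rule divide_right_mono) simp
  also have "\<dots> = 1 - (1 - exp (- norm b)) / card A"
    using assms by (simp add: diff_divide_distrib)
  also have "\<dots> \<le> 1 - (1 - exp (- norm b)) / K"
  proof (intro diff_left_mono divide_left_mono)
    have "0 < card A"
      using assms by (simp add: card_gt_0_iff)
    then show "0 < real K * real (card A)"
      using assms(3) by simp
  qed (use assms in auto)
  finally show ?thesis
    using assms b by (subst integral_unif_dirac) auto
qed

section \<open>Weak convergence versus summability of the maximal norms\<close>

theorem corollary1p2:
  fixes A :: "nat \<Rightarrow> (real ^ 'n) set"
    and \<nu> :: "nat \<Rightarrow> (real ^ 'n) measure"
  assumes fin: "\<And>k. k \<ge> 1 \<Longrightarrow> finite (A k)"
    and nonneg: "\<And>k a i. k \<ge> 1 \<Longrightarrow> a \<in> A k \<Longrightarrow> 0 \<le> a $ i"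
    and card_ge_2: "\<And>k. k \<ge> 1 \<Longrightarrow> 2 \<le> card (A k)"
    and nu: "\<And>n. n \<ge> 1 \<Longrightarrow> \<nu> n = conv_upto (\<lambda>k. unif_dirac (A k)) n"
    and card_bdd: "bdd_above ((\<lambda>k. card (A k)) ` {1..})"
  shows "(\<exists>\<mu> :: (real ^ 'n) measure.
            prob_space \<mu> \<and> sets \<mu> = sets borel \<and> converges_weakly \<nu> \<mu>)
         \<longleftrightarrow> summable (\<lambda>k. Max ((\<lambda>a. norm a) ` A (Suc k)))"
proof -
  have ne: "A k \<noteq> {}" if "k \<ge> 1" for k
    using card_ge_2[OF that] by auto
  define m where "m = (\<lambda>k. Max (norm ` A (Suc k)))"
  have m: "norm a \<le> m k" if "a \<in> A (Suc k)" for a k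
    unfolding m_def using that fin by simp
  have m0: "0 \<le> m k" for k
  proof -
    obtain a where "a \<in> A (Suc k)"
      using ne[of "Suc k"] by auto
    then show ?thesis
      using m[of a k] norm_ge_zero[of a] by linarith
  qed
  \<comment> \<open>The shift is needed because nothing is assumed about \<open>A 0\<close>.\<close>
  define M where "M = (\<lambda>i. unif_dirac (A (Suc i)))"
  have probM: "prob_space (M i)" for i
    unfolding M_def by (simp add: prob_space_unif_dirac fin ne)
  define P where "P = PiM UNIV M"
  define S where "S = (\<lambda>n (\<omega> :: nat \<Rightarrow> real ^ 'n). \<Sum>i\<le>n. \<omega> i)"
  interpret PP: product_prob_space M UNIV
    by (intro product_prob_spaceI probM)
  interpret P: prob_space P
    unfolding P_def by (rule prob_space_PiM) (rule probM)
  have ind: "P.indep_vars (\<lambda>_. borel) (\<lambda>i \<omega>. \<omega> i) UNIV"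
    unfolding P_def by (rule indep_vars_PiM_borel) (rule probM, simp add: M_def)
  then have rv [measurable]: "(\<lambda>\<omega>. \<omega> i) \<in> borel_measurable P" for i
    by (simp add: P.indep_vars_def)
  have S [measurable]: "S n \<in> borel_measurable P" for n
    unfolding S_def by measurable
  have nuS: "\<nu> (Suc n) = distr P borel (S n)" for n
    using distr_sum_eq_conv_upto[of "\<lambda>k. unif_dirac (A k)" n]
    by (simp add: nu P_def M_def S_def prob_space_unif_dirac fin ne)
  \<comment> \<open>Dropping the unspecified term \<open>\<nu> 0\<close> does not affect
    limits.\<close>
  have weak: "converges_weakly \<nu> \<mu> \<longleftrightarrow> converges_weakly (\<lambda>n. distr P borel (S n)) \<mu>" for \<mu>
    unfolding converges_weakly_def nuS[symmetric]
    by (subst filterlim_sequentially_Suc) (rule refl)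
  have comp: "distr P (M i) (\<lambda>\<omega>. \<omega> i) = M i" for i
    by (simp add: PP.PiM_component P_def)
  have mc: "(\<lambda>\<omega>. \<omega> i) \<in> measurable P (M i)" for i
    unfolding P_def by simp
  have "AE \<omega> in P. \<omega> i \<in> A (Suc i)" for i
  proof (rule AE_distrD[OF mc])
    show "AE x in distr P (M i) (\<lambda>\<omega>. \<omega> i). x \<in> A (Suc i)"
      unfolding comp unfolding M_def by (rule AE_unif_dirac) (simp_all add: fin ne)
  qed
  \<comment> \<open>Countably many indices, so one null set serves them all.\<close>
  then have supp: "AE \<omega> in P. \<forall>i. \<omega> i \<in> A (Suc i)"
    by (simp add: AE_all_countable)
  have "(\<exists>\<mu> :: (real ^ 'n) measure.
            prob_space \<mu> \<and> sets \<mu> = sets borel \<and> converges_weakly \<nu> \<mu>) \<longleftrightarrow> summable m"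
  proof
    assume "summable m"
    \<comment> \<open>On the support the series is dominated termwise by \<open>m\<close>. On the
      exceptional null set the value of the infinite sum is irrelevant.\<close>
    have "AE \<omega> in P. (\<lambda>n. S n \<omega>) \<longlonglongrightarrow> (\<Sum>i. \<omega> i)"
      using supp
    proof eventually_elim
      case (elim \<omega>)
      have "summable \<omega>"
        by (rule summable_comparison_test[OF _ \<open>summable m\<close>]) (use elim m in auto)
      then show ?case
        unfolding S_def by (rule summable_LIMSEQ')
    qed
    then have "converges_weakly (\<lambda>n. distr P borel (S n)) (distr P borel (\<lambda>\<omega>. \<Sum>i. \<omega> i))"
      by (intro converges_weakly_if_AE_tendsto P.prob_space_axioms S borel_measurable_suminf rv)
    moreover have "prob_space (distr P borel (\<lambda>\<omega>. \<Sum>i. \<omega> i :: real ^ 'n))"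
      by (intro P.prob_space_distr borel_measurable_suminf rv)
    ultimately show "\<exists>\<mu>. prob_space \<mu> \<and> sets \<mu> = sets borel \<and> converges_weakly \<nu> \<mu>"
      unfolding weak by (intro exI conjI) auto
  next
    assume "\<exists>\<mu>. prob_space \<mu> \<and> sets \<mu> = sets borel \<and> converges_weakly \<nu> \<mu>"
    then obtain \<mu> where \<mu>: "prob_space \<mu>" "sets \<mu> = sets borel"
      and conv: "converges_weakly (\<lambda>n. distr P borel (S n)) \<mu>"
      unfolding weak by blast
    interpret \<mu>: prob_space \<mu> by (rule \<mu>)
    \<comment> \<open>The l1 norm is chosen because it is additive on the nonnegative orthant, which
      the Euclidean norm is not in general.\<close>
    define f where "f = (\<lambda>x :: real ^ 'n. exp (- (\<Sum>j\<in>UNIV. \<bar>x $ j\<bar>)))"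
    have contf: "continuous_on UNIV f"
      unfolding f_def by (intro continuous_intros)
    then have [measurable]: "f \<in> borel_measurable borel"
      by (rule borel_measurable_continuous_onI)
    have f: "0 < f x" "f x \<le> 1" for x
      by (simp_all add: f_def sum_nonneg)
    then have "bounded (range f)"
      unfolding bounded_iff by (intro exI[of _ 1]) (auto simp: less_imp_le abs_of_pos)
    define p where "p = (\<lambda>i. integral\<^sup>L (M i) f)"
    have fM: "f \<in> borel_measurable (M i)" for i
      by (simp add: M_def cong: measurable_cong_sets)
    have p: "0 \<le> p i" "p i \<le> 1" for i
    proof -
      have "integrable (M i) f"
        by (intro PP.M.integrable_const_bound[where B = 1] fM) (auto simp: f less_imp_le)
      then show "p i \<le> 1"
        unfolding p_def by (intro PP.M.integral_le_const) (auto simp: f)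
      show "0 \<le> p i"
        unfolding p_def by (simp add: f less_imp_le)
    qed
    have int_comp: "(\<integral>\<omega>. f (\<omega> i) \<partial>P) = p i" for i
      using integral_distr[OF mc fM, of i] by (simp add: comp p_def)
    have "integral\<^sup>L (distr P borel (S n)) f = (\<Prod>i\<le>n. p i)" for n
    proof -
      have "integral\<^sup>L (distr P borel (S n)) f = (\<integral>\<omega>. f (S n \<omega>) \<partial>P)"
        by (simp add: integral_distr)
      also have "\<dots> = (\<integral>\<omega>. (\<Prod>i\<le>n. f (\<omega> i)) \<partial>P)"
      proof (rule integral_cong_AE)
        show "AE \<omega> in P. f (S n \<omega>) = (\<Prod>i\<le>n. f (\<omega> i))"
          using supp
        proof eventually_elim
          case (elim \<omega>)
          have "0 \<le> \<omega> i $ j" for i j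
            using elim by (intro nonneg[of "Suc i"]) auto
          \<comment> \<open>With nonnegative coordinates the triangle inequality is an
            equality.\<close>
          then have "\<bar>S n \<omega> $ j\<bar> = (\<Sum>i\<le>n. \<bar>\<omega> i $ j\<bar>)" for j
            by (simp add: S_def sum_nonneg)
          then have "(\<Sum>j\<in>UNIV. \<bar>S n \<omega> $ j\<bar>) = (\<Sum>i\<le>n. \<Sum>j\<in>UNIV. \<bar>\<omega> i $ j\<bar>)"
            by (simp only:) (rule sum.swap)
          then show ?case
            unfolding f_def by (simp add: exp_sum flip: sum_negf)
        qed
      qed measurable
      also have "\<dots> = (\<Prod>i\<le>n. \<integral>\<omega>. f (\<omega> i) \<partial>P)"
      proof (rule P.indep_vars_lebesgue_integral)
        have "P.indep_vars (\<lambda>_. borel) (\<lambda>i. f \<circ> (\<lambda>\<omega>. \<omega> i)) {..n}"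
          by (rule P.indep_vars_compose[OF P.indep_vars_subset[OF ind]]) auto
        then show "P.indep_vars (\<lambda>_. borel) (\<lambda>i \<omega>. f (\<omega> i)) {..n}"
          by (simp add: o_def)
        show "integrable P (\<lambda>\<omega>. f (\<omega> i))" for i
          by (rule P.integrable_const_bound[where B = 1]) (auto simp: f less_imp_le)
      qed simp
      finally show ?thesis
        by (simp add: int_comp)
    qed
    moreover have "(\<lambda>n. integral\<^sup>L (distr P borel (S n)) f) \<longlonglongrightarrow> integral\<^sup>L \<mu> f"
      using conv contf \<open>bounded (range f)\<close> unfolding converges_weakly_def by blast
    ultimately have "(\<lambda>n. \<Prod>i\<le>n. p i) \<longlonglongrightarrow> integral\<^sup>L \<mu> f"
      by simp
    \<comment> \<open>The limit has total mass 1 and \<open>f\<close> is positive everywhere; mass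
      escaping to infinity would instead allow the products to tend to 0.\<close>
    moreover have "0 < integral\<^sup>L \<mu> f"
    proof -
      have [measurable]: "f \<in> borel_measurable \<mu>"
        by (simp add: \<mu> cong: measurable_cong_sets)
      have "integrable \<mu> f"
        by (intro \<mu>.integrable_const_bound[where B = 1]) (auto simp: f less_imp_le)
      then show ?thesis
        by (rule \<mu>.expectation_greater) (simp add: f)
    qed
    ultimately have sp: "summable (\<lambda>i. 1 - p i)"
      by (intro summable_if_prod_tendsto_pos p)
    \<comment> \<open>A single \<open>K\<close> for all indices, so comparing
      \<open>1 - exp (- m i)\<close> with \<open>1 - p i\<close> costs only a constant
      factor.\<close>
    obtain K where K: "\<And>k. k \<ge> 1 \<Longrightarrow> card (A k) \<le> K"
      using card_bdd by (auto simp: bdd_above_def)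
    have "0 < K"
      using K[of 1] card_ge_2[of 1] by simp
    have "p i \<le> 1 - (1 - exp (- m i)) / K" for i
      unfolding p_def m_def M_def f_def
      by (rule integral_exp_l1_unif_dirac_le) (simp_all add: fin ne K)
    then have *: "1 - exp (- m i) \<le> K * (1 - p i)" for i
      using \<open>0 < K\<close> by (simp add: field_simps)
    have "summable (\<lambda>i. 1 - exp (- m i))"
    proof (rule summable_comparison_test'[OF summable_mult[OF sp, of "real K"]])
      show "norm (1 - exp (- m i)) \<le> K * (1 - p i)" for i
        using *[of i] m0[of i] by simp
    qed
    then show "summable m"
      by (rule summable_if_summable_one_minus_exp[OF m0])
  qed
  then show ?thesis
    by (simp add: m_def)
qed

end
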